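(* For $n\geq 0$, let $Q(\mathcal P_n)$ be the set of projections of the partition monoid $\mathcal P_n$ of rank at most $2$. Then $$|Q(\mathcal P_n)|=\frac{B(n+2)-B(n+1)+B(n)}{2},$$ where $B(m)$ denotes the $m$th Bell number.
   Context: For an integer $n\ge 0$ let $\mathbf n=\{1,\dots,n\}$ and $\mathbf n'=\{1',\dots,n'\}$. $\mathcal P_n$ is the set of all set partitions of $\mathbf n\cup\mathbf n'$. Product of $\alpha,\beta\in\mathcal P_n$: with $\mathbf n''=\{1'',\dots,n''\}$, rename each $x'$ in $\alpha$ as $x''$ and each (unprimed) $x$ in $\beta$ as $x''$; consider the equivalence on $\mathbf n\cup\mathbf n''\cup\mathbf n'$ generated by the blocks of these two renamed partitions; $x,y\in\mathbf n\cup\mathbf n'$ are in the same block of $\alpha\beta$ iff they are related by this equivalence. $\alpha^*$ is obtained from $\alpha$ by interchanging $x$ and $x'$ for all $x$. The rank of $\alpha$ is the number of its blocks meeting both $\mathbf n$ and $\mathbf n'$. A projection is an element $\varepsilon$ with $\varepsilon^2=\varepsilon=\varepsilon^*$. The Bell number $B(m)$ is the number of set partitions of an $m$-element set ($B(0)=1$). *)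

theory Defs
  imports Complex_Main "HOL-Library.Disjoint_Sets"
begin

text \<open>\<open>Up x\<close>, \<open>Low x\<close> and \<open>Mid x\<close> stand for $x$, $x'$ and $x''$ respectively.\<close>

datatype point = Up nat | Low nat | Mid nat

definition upper :: "nat \<Rightarrow> point set" where
  "upper n = Up ` {1..n}"

definition lower :: "nat \<Rightarrow> point set" where
  "lower n = Low ` {1..n}"

definition middle :: "nat \<Rightarrow> point set" where
  "middle n = Mid ` {1..n}"

definition partition_monoid :: "nat \<Rightarrow> point set set set" where
  "partition_monoid n = {\<alpha>. partition_on (upper n \<union> lower n) \<alpha>}"

fun low_to_mid :: "point \<Rightarrow> point" where
  "low_to_mid (Up x) = Up x"
| "low_to_mid (Low x) = Mid x"
| "low_to_mid (Mid x) = Mid x"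

fun up_to_mid :: "point \<Rightarrow> point" where
  "up_to_mid (Up x) = Mid x"
| "up_to_mid (Low x) = Low x"
| "up_to_mid (Mid x) = Mid x"

fun swap_point :: "point \<Rightarrow> point" where
  "swap_point (Up x) = Low x"
| "swap_point (Low x) = Up x"
| "swap_point (Mid x) = Mid x"

definition same_block :: "'a set set \<Rightarrow> ('a \<times> 'a) set" where
  "same_block P = {(x, y). \<exists>B\<in>P. x \<in> B \<and> y \<in> B}"

text \<open>The equivalence generated by the blocks of the two renamed partitions. Since
  \<open>same_block\<close> is symmetric and every point lies in some block, the transitive closure is
  already the least equivalence relation (see \<open>equiv_product_rel\<close>, \<open>product_rel_least\<close>).\<close>

definition product_rel :: "point set set \<Rightarrow> point set set \<Rightarrow> (point \<times> point) set" where
  "product_rel \<alpha> \<beta> = (same_block (image low_to_mid ` \<alpha>) \<union> same_block (image up_to_mid ` \<beta>))\<^sup>+"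

definition partition_prod :: "nat \<Rightarrow> point set set \<Rightarrow> point set set \<Rightarrow> point set set" where
  "partition_prod n \<alpha> \<beta> =
     (upper n \<union> lower n) //
       (product_rel \<alpha> \<beta> \<inter> (upper n \<union> lower n) \<times> (upper n \<union> lower n))"

definition partition_star :: "point set set \<Rightarrow> point set set" where
  "partition_star \<alpha> = image swap_point ` \<alpha>"

definition partition_rank :: "nat \<Rightarrow> point set set \<Rightarrow> nat" where
  "partition_rank n \<alpha> = card {B \<in> \<alpha>. B \<inter> upper n \<noteq> {} \<and> B \<inter> lower n \<noteq> {}}"

definition is_projection :: "nat \<Rightarrow> point set set \<Rightarrow> bool" where
  "is_projection n \<epsilon> \<longleftrightarrow>
     \<epsilon> \<in> partition_monoid n \<and> partition_prod n \<epsilon> \<epsilon> = \<epsilon> \<and> \<epsilon> = partition_star \<epsilon>"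

definition low_rank_projections :: "nat \<Rightarrow> point set set set" where
  "low_rank_projections n = {\<epsilon>. is_projection n \<epsilon> \<and> partition_rank n \<epsilon> \<le> 2}"

definition Bell :: "nat \<Rightarrow> nat" where
  "Bell m = card {P. partition_on {1..m} P}"

lemma finite_partition_monoid: "finite (partition_monoid n)"
  unfolding partition_monoid_def
  by (rule finitely_many_partition_on) (simp add: upper_def lower_def)

lemma Bell_0: "Bell 0 = 1"
  by (simp add: Bell_def partition_on_empty)

lemma Union_low_to_mid:
  assumes "\<alpha> \<in> partition_monoid n"
  shows "\<Union> (image low_to_mid ` \<alpha>) = upper n \<union> middle n"
proof -
  have "\<Union> (image low_to_mid ` \<alpha>) = low_to_mid ` (upper n \<union> lower n)"
    using assms by (auto simp: partition_monoid_def partition_on_def)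
  also have "\<dots> = upper n \<union> middle n"
    by (simp add: upper_def lower_def middle_def image_Un image_image)
  finally show ?thesis .
qed

lemma Union_up_to_mid:
  assumes "\<beta> \<in> partition_monoid n"
  shows "\<Union> (image up_to_mid ` \<beta>) = middle n \<union> lower n"
proof -
  have "\<Union> (image up_to_mid ` \<beta>) = up_to_mid ` (upper n \<union> lower n)"
    using assms by (auto simp: partition_monoid_def partition_on_def)
  also have "\<dots> = middle n \<union> lower n"
    by (simp add: upper_def lower_def middle_def image_Un image_image)
  finally show ?thesis .
qed

lemma same_block_subset: "same_block P \<subseteq> \<Union>P \<times> \<Union>P"
  by (auto simp: same_block_def)

lemma sym_same_block: "sym (same_block P)"
  by (auto simp: same_block_def sym_def)

lemma equiv_product_rel:
  assumes "\<alpha> \<in> partition_monoid n" "\<beta> \<in> partition_monoid n"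
  shows "equiv (upper n \<union> middle n \<union> lower n) (product_rel \<alpha> \<beta>)"
proof -
  let ?A = "upper n \<union> middle n \<union> lower n"
  let ?P = "image low_to_mid ` \<alpha>" and ?Q = "image up_to_mid ` \<beta>"
  let ?r = "same_block ?P \<union> same_block ?Q"
  have U: "\<Union>?P \<union> \<Union>?Q = ?A"
    unfolding Union_low_to_mid[OF assms(1)] Union_up_to_mid[OF assms(2)] by auto
  have "?r \<subseteq> ?A \<times> ?A"
    unfolding U[symmetric] using same_block_subset[of ?P] same_block_subset[of ?Q]
    by (intro Un_least) (erule order_trans, intro Sigma_mono Un_upper1 Un_upper2)+
  then have 1: "product_rel \<alpha> \<beta> \<subseteq> ?A \<times> ?A"
    unfolding product_rel_def by (rule trancl_subset_Sigma)
  have "(x, x) \<in> ?r" if "x \<in> ?A" for x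
  proof -
    from that have "x \<in> \<Union>?P \<or> x \<in> \<Union>?Q"
      using U by (metis UnE)
    then show ?thesis
      by (simp add: same_block_def)
  qed
  then have 2: "refl_on ?A (product_rel \<alpha> \<beta>)"
    unfolding product_rel_def refl_on_def by blast
  have "sym ?r"
    by (intro sym_Un sym_same_block)
  then have 3: "sym (product_rel \<alpha> \<beta>)"
    unfolding product_rel_def by (rule sym_trancl)
  show ?thesis
    using 1 2 3 by (auto simp: equiv_def product_rel_def)
qed

lemma product_rel_least:
  assumes "equiv (upper n \<union> middle n \<union> lower n) E"
    and "same_block (image low_to_mid ` \<alpha>) \<subseteq> E" "same_block (image up_to_mid ` \<beta>) \<subseteq> E"
  shows "product_rel \<alpha> \<beta> \<subseteq> E"
proof -
  have "product_rel \<alpha> \<beta> \<subseteq> E\<^sup>+"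
    unfolding product_rel_def using assms(2,3) by (meson Un_least trancl_mono subrelI)
  also have "E\<^sup>+ = E"
    using assms(1) by (simp add: equiv_def trancl_id)
  finally show ?thesis .
qed

lemma equiv_product_rel_outer:
  assumes "\<alpha> \<in> partition_monoid n" "\<beta> \<in> partition_monoid n"
  shows "equiv (upper n \<union> lower n)
           (product_rel \<alpha> \<beta> \<inter> (upper n \<union> lower n) \<times> (upper n \<union> lower n))"
proof -
  have E: "equiv (upper n \<union> middle n \<union> lower n) (product_rel \<alpha> \<beta>)"
    using assms by (rule equiv_product_rel)
  show ?thesis
  proof (rule equivI)
    show "refl_on (upper n \<union> lower n)
            (product_rel \<alpha> \<beta> \<inter> (upper n \<union> lower n) \<times> (upper n \<union> lower n))"
      using E by (auto simp: equiv_def refl_on_def)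
    show "sym (product_rel \<alpha> \<beta> \<inter> (upper n \<union> lower n) \<times> (upper n \<union> lower n))"
      using E by (auto simp: equiv_def sym_def)
    show "trans (product_rel \<alpha> \<beta> \<inter> (upper n \<union> lower n) \<times> (upper n \<union> lower n))"
      using E unfolding equiv_def trans_def by blast
  qed blast
qed

lemma partition_prod_closed:
  assumes "\<alpha> \<in> partition_monoid n" "\<beta> \<in> partition_monoid n"
  shows "partition_prod n \<alpha> \<beta> \<in> partition_monoid n"
  using partition_on_quotient[OF equiv_product_rel_outer[OF assms]]
  by (simp add: partition_monoid_def partition_prod_def)

lemma same_block_partition_prod:
  assumes "\<alpha> \<in> partition_monoid n" "\<beta> \<in> partition_monoid n"
    and "x \<in> upper n \<union> lower n" "y \<in> upper n \<union> lower n"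
  shows "(x, y) \<in> same_block (partition_prod n \<alpha> \<beta>) \<longleftrightarrow> (x, y) \<in> product_rel \<alpha> \<beta>"
proof -
  let ?A = "upper n \<union> lower n"
  let ?E = "product_rel \<alpha> \<beta> \<inter> ?A \<times> ?A"
  have E: "equiv ?A ?E"
    using assms(1,2) by (rule equiv_product_rel_outer)
  have "(x, y) \<in> same_block (?A // ?E) \<longleftrightarrow> (x, y) \<in> ?E"
  proof
    assume "(x, y) \<in> same_block (?A // ?E)"
    then show "(x, y) \<in> ?E"
      using quotient_eq_iff[OF E] by (auto simp: same_block_def)
  next
    assume "(x, y) \<in> ?E"
    then have "y \<in> ?E `` {x}"
      by (rule ImageI) simp
    moreover have "x \<in> ?E `` {x}"
      using E assms(3) by (rule equiv_class_self)
    moreover have "?E `` {x} \<in> ?A // ?E"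
      using assms(3) by (rule quotientI)
    ultimately show "(x, y) \<in> same_block (?A // ?E)"
      unfolding same_block_def by (intro CollectI case_prodI bexI conjI)
  qed
  then show ?thesis
    using assms(3,4) by (simp add: partition_prod_def)
qed

end

theory Submission
  imports Defs
begin

text \<open>A projection is a set partition of \<open>{1..n}\<close> with a subset of marked blocks: a marked block
  \<open>A\<close> stands for the transversal $A\cup A'$, an unmarked one for the two blocks $A$ and $A'$. Indeed
  a projection with a transversal $A\cup B'$ contains $B\cup A'$ as well, so its square joins $A$
  to $A'$ and hence $A = B$. The number in question is therefore
  $\sum_\pi (1 + |\pi| + \binom{|\pi|}{2})$, and adding one point (twice) to a set partition shows
  $B(n+1) = \sum_\pi (|\pi|+1)$ and $B(n+2) = \sum_\pi (|\pi|^2 + 2|\pi| + 2)$.\<close>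

section \<open>Set partitions with one more point, Bell numbers, and choices of marks\<close>

text \<open>The choice \<open>B = {}\<close> makes the new point a singleton block.\<close>

lemma partition_on_insert_into_block:
  assumes Q: "partition_on A Q" and x: "x \<notin> A" and B: "B \<in> insert {} Q"
  shows "partition_on (insert x A) (insert (insert x B) (Q - {B}))"
proof -
  have "insert x A - insert x B = A - B" "B \<subseteq> A" using Q B x by (auto simp: partition_on_def)
  moreover have "partition_on (A - B) (Q - {B})"
  proof (cases "B \<in> Q")
    case True
    then have "disjnt B (\<Union>(Q - {B}))"
      using Q by (auto simp: partition_on_def pairwise_def disjnt_def)
    then show ?thesis
      using True Q partition_on_insert[of B "Q - {B}" A] by (simp add: insert_absorb)
  next
    case False
    then show ?thesis using Q B by simp
  qed
  moreover from this have "disjnt (insert x B) (\<Union>(Q - {B}))"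
    using x by (auto simp: partition_on_def disjnt_def)
  ultimately show ?thesis
    by (simp add: partition_on_insert) blast
qed

text \<open>Each partition of \<open>insert x A\<close> arises exactly once from a partition
  \<open>Q\<close> of \<open>A\<close> by choosing where \<open>x\<close> goes: joining one of the
  \<open>card Q\<close> blocks keeps the number of blocks, a singleton block raises it by one. The
  weight \<open>f\<close> lets the recursion be applied repeatedly.\<close>

lemma sum_partition_on_insert:
  fixes f :: "nat \<Rightarrow> nat"
  assumes fin: "finite A" and x: "x \<notin> A"
  shows "(\<Sum>P | partition_on (insert x A) P. f (card P)) =
    (\<Sum>Q | partition_on A Q. card Q * f (card Q) + f (Suc (card Q)))"
proof -
  let ?S = "SIGMA Q:{Q. partition_on A Q}. insert {} Q"
  let ?g = "\<lambda>(Q, B). insert (insert x B) (Q - {B})"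
  \<comment> \<open>Left inverse of \<open>?g\<close>: \<open>B\<close> is the block of
    \<open>x\<close> with \<open>x\<close> removed. It is put back among the blocks unless it is
    empty, that is, unless \<open>x\<close> was alone.\<close>
  let ?h = "\<lambda>P. let B = (THE B. insert x B \<in> P \<and> x \<notin> B) in ((P - {insert x B}) \<union> ({B} - {{}}), B)"
  have finQ: "finite Q" if "partition_on A Q" for Q
    using finite_elements[OF fin that] .
  have notx: "x \<notin> B" if "partition_on A Q" "B \<in> insert {} Q" for Q B
    using that x by (auto simp: partition_on_def)
  have unmark: "?h (?g (Q, B)) = (Q, B)" if "partition_on A Q" "B \<in> insert {} Q" for Q B
  proof -
    have nQ: "\<forall>C\<in>Q. x \<notin> C" "{} \<notin> Q"
      using that x by (auto simp: partition_on_def)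
    then have nx: "insert x C \<notin> Q" for C by auto
    \<comment> \<open>No block of \<open>Q\<close> contains \<open>x\<close>, so the new block is
      the only one of the form \<open>insert x C\<close>, and \<open>x \<notin> C\<close> then
      forces \<open>C = B\<close>.\<close>
    then have "(THE C. insert x C \<in> ?g (Q, B) \<and> x \<notin> C) = B"
      using notx[OF that] by (intro the_equality) (auto simp: insert_ident)
    then show ?thesis
      using that nQ nx by (auto simp: Let_def)
  qed
  have "bij_betw ?g ?S {P. partition_on (insert x A) P}"
    unfolding bij_betw_def
  proof
    show "inj_on ?g ?S"
    proof (rule inj_on_inverseI)
      fix p assume "p \<in> ?S"
      then obtain Q B where "p = (Q, B)" "partition_on A Q" "B \<in> insert {} Q" by auto
      then show "?h (?g p) = p" using unmark by blast
    qed
    show "?g ` ?S = {P. partition_on (insert x A) P}"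
    proof (intro equalityI subsetI)
      fix P assume "P \<in> ?g ` ?S"
      then obtain Q B where *: "P = ?g (Q, B)" "partition_on A Q" "B \<in> insert {} Q" by auto
      show "P \<in> {P. partition_on (insert x A) P}"
        using partition_on_insert_into_block[OF *(2) x *(3)] *(1) by simp
    next
      fix P assume "P \<in> {P. partition_on (insert x A) P}"
      then have P: "partition_on (insert x A) P" by simp
      have UP: "\<Union>P = insert x A" and NP: "{} \<notin> P"
        and DP: "\<And>C D. C \<in> P \<Longrightarrow> D \<in> P \<Longrightarrow> C \<noteq> D \<Longrightarrow> C \<inter> D = {}"
        using P by (auto simp: partition_on_def disjoint_def)
      obtain C where C: "C \<in> P" "x \<in> C" using UP by auto
      define B where "B = C - {x}"
      define Q where "Q = (P - {C}) \<union> ({B} - {{}})"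
      have CB: "C = insert x B" using C by (auto simp: B_def)
      have disj: "D \<inter> C = {}" if "D \<in> P - {C}" for D
        using that DP C by blast
      \<comment> \<open>If \<open>B\<close> were another block, it would be disjoint from
        \<open>C\<close> and contained in \<open>C\<close>, hence empty.\<close>
      have BQ: "B \<notin> P - {C}"
        using disj NP by (metis DiffD1 Int_absorb2 B_def Diff_subset)
      have "disjnt C (\<Union>(P - {C}))"
        using disj by (auto simp: disjnt_def)
      then have "partition_on (insert x A - C) (P - {C})"
        using P C(1) partition_on_insert[of C "P - {C}" "insert x A"] by (simp add: insert_absorb)
      moreover have "insert x A - C = A - B" "B \<subseteq> A"
        using x C UP by (auto simp: B_def)
      moreover have "disjnt B (\<Union>(P - {C}))"
        using disj by (auto simp: disjnt_def B_def)
      ultimately have "partition_on A Q"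
        using partition_on_insert[of B "P - {C}" A] by (cases "B = {}") (simp_all add: Q_def)
      moreover have "B \<in> insert {} Q" by (auto simp: Q_def)
      moreover have "P = ?g (Q, B)"
      proof -
        have "Q - {B} = P - {C}" using BQ by (auto simp: Q_def)
        then show ?thesis using C CB by auto
      qed
      ultimately show "P \<in> ?g ` ?S" by blast
    qed
  qed
  then have "(\<Sum>P | partition_on (insert x A) P. f (card P)) = (\<Sum>p\<in>?S. f (card (?g p)))"
    by (rule sum.reindex_bij_betw[symmetric])
  also have "\<dots> = (\<Sum>(Q, B)\<in>?S. f (card (insert (insert x B) (Q - {B}))))"
    by (rule sum.cong) auto
  also have "\<dots> = (\<Sum>Q | partition_on A Q. \<Sum>B\<in>insert {} Q. f (card (insert (insert x B) (Q - {B}))))"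
    using fin finQ by (intro sum.Sigma[symmetric]) (auto simp: finitely_many_partition_on)
  also have "\<dots> = (\<Sum>Q | partition_on A Q. card Q * f (card Q) + f (Suc (card Q)))"
  proof (rule sum.cong)
    fix Q assume "Q \<in> {Q. partition_on A Q}"
    then have Q: "partition_on A Q" by simp
    have f: "finite Q" and e: "{} \<notin> Q" and nx: "\<And>B. insert x B \<notin> Q"
      using finQ[OF Q] Q x by (auto simp: partition_on_def)
    \<comment> \<open>Enlarging a block replaces it by a set not in \<open>Q\<close>, so removal and
      insertion balance. For \<open>B = {}\<close> nothing is removed.\<close>
    have "card (insert (insert x B) (Q - {B})) = card Q" if "B \<in> Q" for B
      using f nx that card_Suc_Diff1[of Q B] by simp
    moreover have "card (insert (insert x {}) (Q - {{}})) = Suc (card Q)"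
      using f nx e by simp
    ultimately show "(\<Sum>B\<in>insert {} Q. f (card (insert (insert x B) (Q - {B})))) =
        card Q * f (card Q) + f (Suc (card Q))"
      using f e by simp
  qed simp
  finally show ?thesis .
qed

lemma sum_partition_on_Suc:
  fixes f :: "nat \<Rightarrow> nat"
  shows "(\<Sum>P | partition_on {1..Suc n} P. f (card P)) =
    (\<Sum>Q | partition_on {1..n} Q. card Q * f (card Q) + f (Suc (card Q)))"
proof -
  have "{1..Suc n} = insert (Suc n) {1..n}" by auto
  then show ?thesis using sum_partition_on_insert[of "{1..n}" "Suc n" f] by simp
qed

lemma Bell_eq_sum: "Bell m = (\<Sum>P | partition_on {1..m} P. 1)"
  by (simp add: Bell_def)

lemma Bell_Suc_eq_sum: "Bell (Suc n) = (\<Sum>P | partition_on {1..n} P. card P + 1)"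
  using sum_partition_on_Suc[of "\<lambda>_. 1" n] by (simp add: Bell_def)

text \<open>The recursion for the weight \<open>k + 1\<close>, whose sum over the partitions of
  \<open>{1..Suc n}\<close> is the Bell number. The summand equals $k^2+2k+2$ with
  \<open>k = card P\<close>.\<close>

lemma Bell_Suc_Suc_eq_sum:
  "Bell (Suc (Suc n)) = (\<Sum>P | partition_on {1..n} P. card P * (card P + 1) + (Suc (card P) + 1))"
  unfolding Bell_Suc_eq_sum[of "Suc n"] by (rule sum_partition_on_Suc)

text \<open>Marked blocks become the transversals, so these are the admissible mark sets for rank at
  most 2.\<close>

lemma card_subsets_card_le_2:
  assumes "finite A"
  shows "card {M. M \<subseteq> A \<and> card M \<le> 2} = 1 + card A + (card A choose 2)"
proof -
  have "{M. M \<subseteq> A \<and> card M \<le> 2} = (\<Union>k\<in>{0,1,2}. {M. M \<subseteq> A \<and> card M = k})"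
    by auto
  also have "card \<dots> = (\<Sum>k\<in>{0,1,2}. card {M. M \<subseteq> A \<and> card M = k})"
    using assms by (intro card_UN_disjoint) auto
  also have "\<dots> = 1 + card A + (card A choose 2)"
    using assms by (simp add: n_subsets)
  finally show ?thesis .
qed

section \<open>Marked partitions as elements of the partition monoid\<close>

definition both :: "nat set \<Rightarrow> point set" where
  "both A = Up ` A \<union> Low ` A"

definition marked_partition :: "nat set set \<Rightarrow> nat set set \<Rightarrow> point set set" where
  "marked_partition \<pi> M = both ` M \<union> image Up ` (\<pi> - M) \<union> image Low ` (\<pi> - M)"

lemma both_eq_image_iff: "both A = Up ` B \<longleftrightarrow> A = {} \<and> B = {}" "both A = Low ` B \<longleftrightarrow> A = {} \<and> B = {}"
  by (auto simp: both_def)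

lemma both_eq_iff: "both A = both B \<longleftrightarrow> A = B"
  by (auto simp: both_def)

lemma both_vimage_Up:
  assumes "\<And>c. Mid c \<notin> B" "\<And>c. Low c \<in> B \<longleftrightarrow> Up c \<in> B"
  shows "both (Up -` B) = B"
proof (rule set_eqI)
  show "x \<in> both (Up -` B) \<longleftrightarrow> x \<in> B" for x
    using assms by (cases x) (auto simp: both_def)
qed

lemma image_vimage_Up:
  assumes "\<And>c. Mid c \<notin> B" "\<And>c. Low c \<notin> B"
  shows "Up ` (Up -` B) = B"
proof (rule set_eqI)
  show "x \<in> Up ` (Up -` B) \<longleftrightarrow> x \<in> B" for x
    using assms by (cases x) auto
qed

lemma swap_point_swap_point: "swap_point (swap_point x) = x"
  by (cases x) auto

lemma swap_point_image: "swap_point ` Up ` A = Low ` A" "swap_point ` Low ` A = Up ` A"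
    "swap_point ` both A = both A"
  by (auto simp: both_def image_Un image_image)

lemma partition_star_marked_partition:
  "partition_star (marked_partition \<pi> M) = marked_partition \<pi> M"
  unfolding partition_star_def marked_partition_def
  by (simp add: image_Un image_image swap_point_image Un_ac)

lemma upper_lower_eq_both: "upper n \<union> lower n = both {1..n}"
  by (simp add: upper_def lower_def both_def)

text \<open>Groups the blocks by the \<open>A\<close> they come from, which is the shape needed for
  \<open>partition_on_UN\<close>.\<close>

lemma marked_partition_eq_UN:
  assumes "M \<subseteq> \<pi>"
  shows "marked_partition \<pi> M = (\<Union>A\<in>\<pi>. if A \<in> M then {both A} else {Up ` A, Low ` A})"
  using assms by (auto simp: marked_partition_def split: if_splits)

text \<open>Two blocks over the same \<open>C\<close> are disjoint because \<open>F C\<close> is a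
  partition; over different \<open>C\<close> they lie in disjoint sets \<open>G C\<close>. It serves
  both for the two outer rows and for all three rows.\<close>

lemma partition_on_UN:
  assumes \<pi>: "partition_on A \<pi>" and F: "\<And>C. C \<in> \<pi> \<Longrightarrow> partition_on (G C) (F C)"
    and G: "\<And>C D. C \<in> \<pi> \<Longrightarrow> D \<in> \<pi> \<Longrightarrow> disjnt C D \<Longrightarrow> disjnt (G C) (G D)"
  shows "partition_on (\<Union>C\<in>\<pi>. G C) (\<Union>C\<in>\<pi>. F C)"
proof (rule partition_onI)
  have "G C = \<Union>(F C)" if "C \<in> \<pi>" for C
    using F[OF that] by (rule partition_onD1)
  then show "\<Union>(\<Union>C\<in>\<pi>. F C) = (\<Union>C\<in>\<pi>. G C)"
    by auto
  show "{} \<notin> (\<Union>C\<in>\<pi>. F C)"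
    using F by (auto simp: partition_on_def)
  fix p q assume "p \<in> (\<Union>C\<in>\<pi>. F C)" "q \<in> (\<Union>C\<in>\<pi>. F C)" "p \<noteq> q"
  then obtain C D where CD: "C \<in> \<pi>" "D \<in> \<pi>" "p \<in> F C" "q \<in> F D" by blast
  show "disjnt p q"
  proof (cases "C = D")
    case True
    then show ?thesis
      using partition_onD2[OF F[OF CD(1)]] CD \<open>p \<noteq> q\<close> by (auto simp: pairwise_def)
  next
    case False
    then have "disjnt C D"
      using partition_onD2[OF \<pi>] CD by (auto simp: pairwise_def)
    then have "disjnt (G C) (G D)"
      using G CD by blast
    moreover have "p \<subseteq> G C" "q \<subseteq> G D"
      using partition_onD1[OF F[OF CD(1)]] partition_onD1[OF F[OF CD(2)]] CD by auto
    ultimately show ?thesis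
      by (meson disjnt_subset1 disjnt_subset2)
  qed
qed

lemma marked_partition_in_partition_monoid:
  assumes \<pi>: "partition_on {1..n} \<pi>" and M: "M \<subseteq> \<pi>"
  shows "marked_partition \<pi> M \<in> partition_monoid n"
proof -
  have "partition_on (\<Union>A\<in>\<pi>. both A) (\<Union>A\<in>\<pi>. if A \<in> M then {both A} else {Up ` A, Low ` A})"
  proof (rule partition_on_UN[OF \<pi>])
    fix A assume "A \<in> \<pi>"
    then have "A \<noteq> {}" using \<pi> by (auto simp: partition_on_def)
    then show "partition_on (both A) (if A \<in> M then {both A} else {Up ` A, Low ` A})"
      by (auto simp: partition_on_def both_def disjoint_def)
  qed (auto simp: both_def disjnt_iff)
  moreover have "(\<Union>A\<in>\<pi>. both A) = both {1..n}"
    unfolding partition_onD1[OF \<pi>] by (auto simp: both_def)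
  ultimately show ?thesis
    unfolding partition_monoid_def upper_lower_eq_both marked_partition_eq_UN[OF M] by simp
qed

section \<open>The square of a marked partition\<close>

text \<open>Used to show that the generators of the product relation lie in a candidate equivalence
  given by its blocks \<open>T\<close>.\<close>

lemma same_block_image_subset:
  assumes "\<And>B. B \<in> P \<Longrightarrow> \<exists>C\<in>T. f ` B \<subseteq> C"
  shows "same_block (image f ` P) \<subseteq> same_block T"
proof (rule subrelI)
  fix x y assume "(x, y) \<in> same_block (image f ` P)"
  then obtain B where B: "B \<in> P" "x \<in> f ` B" "y \<in> f ` B"
    by (auto simp: same_block_def)
  obtain C where C: "C \<in> T" "f ` B \<subseteq> C" using assms[OF B(1)] by (rule bexE)
  show "(x, y) \<in> same_block T"
    using C(1) subsetD[OF C(2) B(2)] subsetD[OF C(2) B(3)] by (auto simp: same_block_def)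
qed

lemma same_block_imageI: "B \<in> P \<Longrightarrow> u \<in> B \<Longrightarrow> v \<in> B \<Longrightarrow> (f u, f v) \<in> same_block (image f ` P)"
  unfolding same_block_def by (intro CollectI case_prodI bexI[OF _ imageI] conjI imageI)

text \<open>The square of a marked partition is computed on all three rows at once; the middle row
  of an unmarked block is a component of its own.\<close>

lemma partition_prod_marked_partition:
  assumes \<pi>: "partition_on {1..n} \<pi>" and M: "M \<subseteq> \<pi>"
  shows "partition_prod n (marked_partition \<pi> M) (marked_partition \<pi> M) = marked_partition \<pi> M"
proof -
  let ?\<epsilon> = "marked_partition \<pi> M" and ?A = "upper n \<union> lower n"
  let ?F = "\<lambda>A. if A \<in> M then {both A \<union> Mid ` A} else {Up ` A, Low ` A, Mid ` A}"
  let ?T = "\<Union>A\<in>\<pi>. ?F A"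
  have \<epsilon>: "?\<epsilon> \<in> partition_monoid n"
    using assms by (rule marked_partition_in_partition_monoid)
  have \<epsilon>_cases: "\<exists>A\<in>\<pi>. A \<in> M \<and> B = both A \<or> A \<notin> M \<and> (B = Up ` A \<or> B = Low ` A)" if "B \<in> ?\<epsilon>" for B
    using that M by (auto simp: marked_partition_def)
  have low_mid: "low_to_mid ` Up ` A = Up ` A" "low_to_mid ` Low ` A = Mid ` A"
    and up_mid: "up_to_mid ` Up ` A = Mid ` A" "up_to_mid ` Low ` A = Low ` A" for A
    by (auto simp: image_image)
  have rows: "(\<Union>A\<in>\<pi>. both A \<union> Mid ` A) = upper n \<union> middle n \<union> lower n"
    unfolding upper_def middle_def lower_def partition_onD1[OF \<pi>] by (auto simp: both_def)
  have "partition_on (upper n \<union> middle n \<union> lower n) ?T"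
    unfolding rows[symmetric]
  proof (rule partition_on_UN[OF \<pi>])
    fix A assume "A \<in> \<pi>"
    then have "A \<noteq> {}" using \<pi> by (auto simp: partition_on_def)
    then show "partition_on (both A \<union> Mid ` A) (?F A)"
      by (auto simp: partition_on_def both_def disjoint_def)
  qed (auto simp: both_def disjnt_iff)
  then have "equiv (upper n \<union> middle n \<union> lower n) (same_block ?T)"
    unfolding same_block_def by (rule equiv_partition_on)
  moreover have "same_block (image low_to_mid ` ?\<epsilon>) \<subseteq> same_block ?T"
  proof (rule same_block_image_subset)
    fix B assume "B \<in> ?\<epsilon>"
    then obtain A where A: "A \<in> \<pi>" "A \<in> M \<and> B = both A \<or> A \<notin> M \<and> (B = Up ` A \<or> B = Low ` A)"
      using \<epsilon>_cases by blast
    then have "\<exists>C\<in>?F A. low_to_mid ` B \<subseteq> C"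
      by (auto simp: both_def image_Un low_mid)
    then show "\<exists>C\<in>?T. low_to_mid ` B \<subseteq> C" using A(1) by blast
  qed
  moreover have "same_block (image up_to_mid ` ?\<epsilon>) \<subseteq> same_block ?T"
  proof (rule same_block_image_subset)
    fix B assume "B \<in> ?\<epsilon>"
    then obtain A where A: "A \<in> \<pi>" "A \<in> M \<and> B = both A \<or> A \<notin> M \<and> (B = Up ` A \<or> B = Low ` A)"
      using \<epsilon>_cases by blast
    then have "\<exists>C\<in>?F A. up_to_mid ` B \<subseteq> C"
      by (auto simp: both_def image_Un up_mid)
    then show "\<exists>C\<in>?T. up_to_mid ` B \<subseteq> C" using A(1) by blast
  qed
  ultimately have "product_rel ?\<epsilon> ?\<epsilon> \<subseteq> same_block ?T"
    by (rule product_rel_least)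
  \<comment> \<open>Away from the middle row, the classes of \<open>?T\<close> reduce to blocks of
    the marked partition: \<open>both A \<union> Mid\<close>
    A\<open>loses its middle part, and\<close>Mid \<open>A\<close> alone disappears.\<close>
  moreover have "same_block ?T \<inter> ?A \<times> ?A \<subseteq> same_block ?\<epsilon>"
  proof (rule subrelI)
    fix x y assume xy: "(x, y) \<in> same_block ?T \<inter> ?A \<times> ?A"
    then obtain A C where A: "A \<in> \<pi>" and C: "C \<in> ?F A" "x \<in> C" "y \<in> C"
      unfolding same_block_def by blast
    have "x \<notin> Mid ` A" "y \<notin> Mid ` A"
      using xy by (auto simp: upper_def lower_def)
    then have "\<exists>B\<in>(if A \<in> M then {both A} else {Up ` A, Low ` A}). x \<in> B \<and> y \<in> B"
      using C by (auto split: if_splits)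
    then show "(x, y) \<in> same_block ?\<epsilon>"
      unfolding same_block_def marked_partition_eq_UN[OF M] using A by blast
  qed
  moreover have "same_block ?\<epsilon> \<subseteq> product_rel ?\<epsilon> ?\<epsilon>"
  proof (rule subrelI)
    fix x y assume "(x, y) \<in> same_block ?\<epsilon>"
    then obtain B where B: "B \<in> ?\<epsilon>" "x \<in> B" "y \<in> B" by (auto simp: same_block_def)
    have 1: "(low_to_mid u, low_to_mid v) \<in> product_rel ?\<epsilon> ?\<epsilon>"
      "(up_to_mid u, up_to_mid v) \<in> product_rel ?\<epsilon> ?\<epsilon>" if "u \<in> B" "v \<in> B" for u v
      unfolding product_rel_def
      by (rule r_into_trancl, rule UnI1, rule same_block_imageI[OF B(1) that])
        (rule r_into_trancl, rule UnI2, rule same_block_imageI[OF B(1) that])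
    have tr: "trans (product_rel ?\<epsilon> ?\<epsilon>)"
      by (simp add: product_rel_def)
    consider (up) A where "B = Up ` A" | (low) A where "B = Low ` A" | (both) A where "B = both A"
      using B(1) by (auto simp: marked_partition_def)
    then show "(x, y) \<in> product_rel ?\<epsilon> ?\<epsilon>"
    proof cases
      \<comment> \<open>\<open>low_to_mid\<close> fixes upper points, so the first factor already
        relates \<open>x\<close> and \<open>y\<close>; for lower points \<open>up_to_mid\<close> and
        the second factor do the same.\<close>
      case up
      then show ?thesis using 1(1)[OF B(2,3)] B(2,3) by auto
    next
      case low
      then show ?thesis using 1(2)[OF B(2,3)] B(2,3) by auto
    next
      case (both A)
      \<comment> \<open>A point of a marked block is linked to \<open>Mid a\<close> directly: an
        upper point through the first factor, where \<open>Low a\<close> becomes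
        \<open>Mid a\<close>, a lower point through the second, where \<open>Up a\<close>
        does.\<close>
      have mid: "(x, Mid a) \<in> product_rel ?\<epsilon> ?\<epsilon>" "(Mid a, x) \<in> product_rel ?\<epsilon> ?\<epsilon>" if "x \<in> B" "a \<in> A" for x a
      proof -
        have *: "Up a \<in> B" "Low a \<in> B" using that both by (auto simp: both_def)
        show "(x, Mid a) \<in> product_rel ?\<epsilon> ?\<epsilon>" "(Mid a, x) \<in> product_rel ?\<epsilon> ?\<epsilon>"
          using 1(1)[OF \<open>x \<in> B\<close> *(2)] 1(1)[OF *(2) \<open>x \<in> B\<close>] 1(2)[OF \<open>x \<in> B\<close> *(1)] 1(2)[OF *(1) \<open>x \<in> B\<close>]
            that(1) both
          by (cases x; auto simp: both_def)+
      qed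
      obtain a where "a \<in> A" using B(2) both by (auto simp: both_def)
      then show ?thesis using mid B(2,3) tr by (meson transD)
    qed
  qed
  moreover have "same_block ?\<epsilon> \<subseteq> ?A \<times> ?A"
    using same_block_subset[of ?\<epsilon>] \<epsilon> by (simp add: partition_monoid_def partition_on_def)
  ultimately have "product_rel ?\<epsilon> ?\<epsilon> \<inter> ?A \<times> ?A = same_block ?\<epsilon>"
    by blast
  then show ?thesis
    using partition_on_eq_quotient[of ?A ?\<epsilon>] \<epsilon>
    by (simp add: partition_prod_def partition_monoid_def same_block_def)
qed

section \<open>Every projection is a marked partition\<close>

lemma projection_eq_marked_partition:
  assumes "is_projection n \<epsilon>"
  obtains \<pi> M where "partition_on {1..n} \<pi>" "M \<subseteq> \<pi>" "\<epsilon> = marked_partition \<pi> M"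
proof -
  have \<epsilon>: "\<epsilon> \<in> partition_monoid n" and sq: "partition_prod n \<epsilon> \<epsilon> = \<epsilon>" and star: "\<epsilon> = partition_star \<epsilon>"
    using assms by (auto simp: is_projection_def)
  have U: "\<Union>\<epsilon> = both {1..n}" and N: "{} \<notin> \<epsilon>"
    and D: "\<And>C D x. C \<in> \<epsilon> \<Longrightarrow> D \<in> \<epsilon> \<Longrightarrow> x \<in> C \<Longrightarrow> x \<in> D \<Longrightarrow> C = D"
    using \<epsilon> by (auto simp: partition_monoid_def upper_lower_eq_both partition_on_def disjoint_def)
  have swap: "swap_point ` B \<in> \<epsilon>" if "B \<in> \<epsilon>" for B
    using star that by (auto simp: partition_star_def)
  have noMid: "Mid a \<notin> B" if "B \<in> \<epsilon>" for a B
    using U that by (auto simp: both_def)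
  \<comment> \<open>The reflected block contains \<open>Up b\<close> and \<open>Low a\<close>. Hence
    \<open>Up a\<close>, \<open>Mid b\<close>, \<open>Low a\<close> is a path in the product, and
    idempotency puts \<open>Low a\<close> into \<open>B\<close>. Now \<open>B\<close> and its
    reflection share \<open>Low a\<close>, so they coincide and \<open>B\<close> is
    symmetric.\<close>
  have transversal: "B = both (Up -` B)" if B: "B \<in> \<epsilon>" and a: "Up a \<in> B" and b: "Low b \<in> B" for B a b
  proof -
    have ab: "Up a \<in> upper n \<union> lower n" "Low a \<in> upper n \<union> lower n"
    proof -
      have "Up a \<in> both {1..n}" using U B a by blast
      then show "Up a \<in> upper n \<union> lower n" "Low a \<in> upper n \<union> lower n"
        by (auto simp: both_def upper_def lower_def)
    qed
    have b': "Up b \<in> swap_point ` B" "Low a \<in> swap_point ` B"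
      using imageI[OF a, of swap_point] imageI[OF b, of swap_point] by simp_all
    have "(low_to_mid (Up a), low_to_mid (Low b)) \<in> same_block (image low_to_mid ` \<epsilon>)"
      using B a b by (rule same_block_imageI)
    moreover have "(up_to_mid (Up b), up_to_mid (Low a)) \<in> same_block (image up_to_mid ` \<epsilon>)"
      using swap[OF B] b' by (rule same_block_imageI)
    ultimately have "(Up a, Mid b) \<in> product_rel \<epsilon> \<epsilon>" "(Mid b, Low a) \<in> product_rel \<epsilon> \<epsilon>"
      unfolding product_rel_def by (simp_all add: r_into_trancl)
    then have "(Up a, Low a) \<in> product_rel \<epsilon> \<epsilon>"
      unfolding product_rel_def by (rule trancl_trans)
    then have "(Up a, Low a) \<in> same_block \<epsilon>"
      using same_block_partition_prod[OF \<epsilon> \<epsilon> ab] sq by simp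
    then have "Low a \<in> B"
      using D B a by (auto simp: same_block_def)
    then have eq: "swap_point ` B = B"
      using D[OF swap[OF B] B] b'(2) by blast
    have "Low c \<in> B \<longleftrightarrow> Up c \<in> B" for c
      using eq by (metis imageI swap_point.simps(1,2))
    then show ?thesis
      using both_vimage_Up[of B] noMid[OF B] by simp
  qed
  \<comment> \<open>Traces of the blocks on the upper row; blocks inside the lower row have empty
    trace, which is dropped.\<close>
  define \<pi> where "\<pi> = (\<lambda>B. Up -` B) ` \<epsilon> - {{}}"
  define M where "M = {A \<in> \<pi>. both A \<in> \<epsilon>}"
  have "Up -` both {1..n} = {1..n}" by (auto simp: both_def)
  then have "partition_on {1..n} \<pi>"
    using partition_on_vimage[of "both {1..n}" \<epsilon> Up] \<epsilon>
    by (simp add: \<pi>_def partition_monoid_def upper_lower_eq_both)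
  moreover have "M \<subseteq> \<pi>" by (auto simp: M_def)
  moreover have "\<epsilon> = marked_partition \<pi> M"
  proof (intro equalityI subsetI)
    fix B assume B: "B \<in> \<epsilon>"
    have upper_only: "C \<in> image Up ` (\<pi> - M)" if C: "C \<in> \<epsilon>" and l: "\<And>b. Low b \<notin> C" for C
    proof -
      have CA: "C = Up ` (Up -` C)"
        using image_vimage_Up[of C] l noMid[OF C] by simp
      have "C \<noteq> {}" using C N by auto
      then have ne: "Up -` C \<noteq> {}" using CA by (metis image_empty)
      have "both (Up -` C) \<notin> \<epsilon>"
      proof
        assume "both (Up -` C) \<in> \<epsilon>"
        moreover obtain c where "Up c \<in> C" using ne by auto
        ultimately have "both (Up -` C) = C"
          using D[OF _ C, of "both (Up -` C)" "Up c"] by (simp add: both_def)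
        then show False using l ne by (auto simp: both_def)
      qed
      then have "Up -` C \<in> \<pi> - M" using C ne by (auto simp: \<pi>_def M_def)
      then show ?thesis using CA by blast
    qed
    consider (both) a b where "Up a \<in> B" "Low b \<in> B" | (up) "\<And>b. Low b \<notin> B" | (low) "\<And>a. Up a \<notin> B"
      by blast
    then show "B \<in> marked_partition \<pi> M"
    proof cases
      case both
      then have eq: "B = both (Up -` B)" using transversal B by blast
      moreover have "Up -` B \<in> M"
        using both B eq by (auto simp: M_def \<pi>_def)
      ultimately show ?thesis unfolding marked_partition_def by blast
    next
      case up
      then show ?thesis using upper_only B by (auto simp: marked_partition_def)
    next
      case low
      \<comment> \<open>A block in the lower row is reflected into the upper row, treated there by
        \<open>upper_only\<close>, and reflected back.\<close>
      have "Low b \<notin> swap_point ` B" for b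
        using low by (metis imageE swap_point_swap_point swap_point.simps(2))
      then obtain A where A: "A \<in> \<pi> - M" "swap_point ` B = Up ` A"
        using upper_only[OF swap[OF B]] by blast
      have "B = swap_point ` swap_point ` B"
        by (simp add: image_image swap_point_swap_point)
      then have "B = Low ` A" using A by (simp add: swap_point_image)
      then show ?thesis using A by (auto simp: marked_partition_def)
    qed
  next
    fix B assume "B \<in> marked_partition \<pi> M"
    moreover have "Up ` A \<in> \<epsilon>" if A: "A \<in> \<pi> - M" for A
    proof -
      obtain C where C: "C \<in> \<epsilon>" "A = Up -` C" "A \<noteq> {}" using A by (auto simp: \<pi>_def)
      then obtain a where a: "Up a \<in> C" by auto
      \<comment> \<open>A lower point would make \<open>C\<close> a transversal equal to
        \<open>both A\<close>, and \<open>A\<close> would be marked.\<close>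
      have "Low b \<notin> C" for b
        using transversal[OF C(1) a, of b] C A by (auto simp: M_def)
      then have "C = Up ` A"
        using image_vimage_Up[of C] noMid[OF C(1)] C(2) by simp
      then show ?thesis using C by simp
    qed
    moreover from this have "Low ` A \<in> \<epsilon>" if "A \<in> \<pi> - M" for A
      using swap that by (metis swap_point_image(1))
    ultimately show "B \<in> \<epsilon>"
      by (auto simp: marked_partition_def M_def)
  qed
  ultimately show thesis by (rule that)
qed

section \<open>Rank and the bijection with marked partitions\<close>

text \<open>Blocks of \<open>\<pi>\<close> are nonempty, so the blocks meeting both rows are exactly
  the sets \<open>both A\<close> with \<open>A\<close> marked, and \<open>both\<close> is
  injective.\<close>

lemma partition_rank_marked_partition:
  assumes "partition_on {1..n} \<pi>" and M: "M \<subseteq> \<pi>"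
  shows "partition_rank n (marked_partition \<pi> M) = card M"
proof -
  have ne: "A \<noteq> {} \<and> A \<subseteq> {1..n}" if "A \<in> \<pi>" for A
    using assms that by (auto simp: partition_on_def)
  have "both A \<inter> upper n \<noteq> {} \<and> both A \<inter> lower n \<noteq> {}" if "A \<in> M" for A
    using ne[of A] that M unfolding both_def upper_def lower_def by blast
  moreover have "Up a \<notin> lower n" "Low a \<notin> upper n" for a
    by (auto simp: upper_def lower_def)
  ultimately have "{B \<in> marked_partition \<pi> M. B \<inter> upper n \<noteq> {} \<and> B \<inter> lower n \<noteq> {}} = both ` M"
    unfolding marked_partition_def by auto
  moreover have "inj_on both M" by (auto simp: inj_on_def both_eq_iff)
  ultimately show ?thesis by (simp add: partition_rank_def card_image)
qed

text \<open>Decoding maps that give injectivity: the upper traces return \<open>\<pi>\<close>, the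
  blocks of the form \<open>both A\<close> return the marks.\<close>

lemma marked_partition_recover:
  assumes "{} \<notin> \<pi>" and M: "M \<subseteq> \<pi>"
  shows "(\<lambda>B. Up -` B) ` marked_partition \<pi> M - {{}} = \<pi>"
    and "{A. A \<noteq> {} \<and> both A \<in> marked_partition \<pi> M} = M"
proof -
  have v: "Up -` both A = A" "Up -` Up ` A = A" "Up -` Low ` A = {}" for A
    by (auto simp: both_def)
  show "(\<lambda>B. Up -` B) ` marked_partition \<pi> M - {{}} = \<pi>"
    using assms unfolding marked_partition_def image_Un image_image v by auto
  show "{A. A \<noteq> {} \<and> both A \<in> marked_partition \<pi> M} = M"
    using assms unfolding marked_partition_def by (auto simp: both_eq_iff both_eq_image_iff)
qed

lemma bij_betw_marked_partition:
  "bij_betw (\<lambda>(\<pi>, M). marked_partition \<pi> M)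
    (SIGMA \<pi>:{\<pi>. partition_on {1..n} \<pi>}. {M. M \<subseteq> \<pi> \<and> card M \<le> 2}) (low_rank_projections n)"
  unfolding bij_betw_def
proof
  let ?S = "SIGMA \<pi>:{\<pi>. partition_on {1..n} \<pi>}. {M. M \<subseteq> \<pi> \<and> card M \<le> 2}"
  let ?g = "\<lambda>(\<pi>, M). marked_partition \<pi> M"
  show "inj_on ?g ?S"
  proof (rule inj_on_inverseI)
    fix p assume "p \<in> ?S"
    then obtain \<pi> M where p: "p = (\<pi>, M)" and *: "{} \<notin> \<pi>" "M \<subseteq> \<pi>"
      by (auto simp: partition_on_def)
    show "(\<lambda>\<epsilon>. ((\<lambda>B. Up -` B) ` \<epsilon> - {{}}, {A. A \<noteq> {} \<and> both A \<in> \<epsilon>})) (?g p) = p"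
      using marked_partition_recover[OF *] p by simp
  qed
  show "?g ` ?S = low_rank_projections n"
  proof (intro equalityI subsetI)
    fix \<epsilon> assume "\<epsilon> \<in> ?g ` ?S"
    then obtain \<pi> M where "partition_on {1..n} \<pi>" "M \<subseteq> \<pi>" "card M \<le> 2" "\<epsilon> = marked_partition \<pi> M"
      by auto
    then show "\<epsilon> \<in> low_rank_projections n"
      by (simp add: low_rank_projections_def is_projection_def marked_partition_in_partition_monoid
          partition_prod_marked_partition partition_star_marked_partition partition_rank_marked_partition)
  next
    fix \<epsilon> assume \<epsilon>: "\<epsilon> \<in> low_rank_projections n"
    then have "is_projection n \<epsilon>"
      by (simp add: low_rank_projections_def)
    then obtain \<pi> M where *: "partition_on {1..n} \<pi>" "M \<subseteq> \<pi>" "\<epsilon> = marked_partition \<pi> M"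
      by (rule projection_eq_marked_partition)
    then have "card M \<le> 2"
      using \<epsilon> by (simp add: low_rank_projections_def partition_rank_marked_partition)
    then show "\<epsilon> \<in> ?g ` ?S" using * by force
  qed
qed

section \<open>Evaluation of the count\<close>

theorem proposition7p4:
  fixes n :: nat
  shows "real (card (low_rank_projections n)) =
    (real (Bell (n + 2)) - real (Bell (n + 1)) + real (Bell n)) / 2"
proof -
  have fin: "finite {\<pi>. partition_on {1..n} \<pi>}"
    by (rule finitely_many_partition_on) simp
  have fin\<pi>: "finite \<pi>" if "partition_on {1..n} \<pi>" for \<pi>
    using finite_elements[OF _ that] by simp
  have "card (low_rank_projections n) =
      (\<Sum>\<pi> | partition_on {1..n} \<pi>. card {M. M \<subseteq> \<pi> \<and> card M \<le> 2})"
    using bij_betw_same_card[OF bij_betw_marked_partition[of n]] fin fin\<pi> by simp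
  also have "\<dots> = (\<Sum>\<pi> | partition_on {1..n} \<pi>. 1 + card \<pi> + (card \<pi> choose 2))"
    by (intro sum.cong) (auto simp: card_subsets_card_le_2 fin\<pi>)
  finally have card: "card (low_rank_projections n) =
      (\<Sum>\<pi> | partition_on {1..n} \<pi>. 1 + card \<pi> + (card \<pi> choose 2))" .
  have choose: "2 * (k choose 2) + k = k * k" for k :: nat
    by (induction k) (simp_all add: numeral_2_eq_2)
  \<comment> \<open>The claimed formula for a single partition with \<open>k\<close> blocks: the
    summand of \<open>Bell (n + 1)\<close> is moved to the left, which avoids truncated subtraction,
    and the final \<open>1\<close> is the summand of \<open>Bell n\<close>.\<close>
  have "2 * (1 + k + (k choose 2)) + (k + 1) = k * (k + 1) + (Suc k + 1) + 1" for k :: nat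
    using choose[of k] by simp
  then have "2 * card (low_rank_projections n) + Bell (Suc n) = Bell (Suc (Suc n)) + Bell n"
    unfolding card Bell_Suc_Suc_eq_sum Bell_Suc_eq_sum[of n] Bell_eq_sum[of n] sum_distrib_left
      sum.distrib[symmetric]
    by (intro sum.cong refl)
  then have "2 * real (card (low_rank_projections n)) + real (Bell (Suc n)) =
      real (Bell (Suc (Suc n))) + real (Bell n)"
    by (metis of_nat_add of_nat_mult of_nat_numeral)
  then show ?thesis by simp
qed

end
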